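(* Let $R$ be a commutative ring with $1\neq0$, let $S$ be a strongly multiplicative set of $R$, and let $I$ be an ideal of $R$ with $I\cap S=\varnothing$. Then there exists a maximal ideal of $R$ containing $I$ and disjoint from $S$. Moreover, every ideal of $R$ that is maximal with respect to containing $I$ and being disjoint from $S$ is a maximal ideal of $R$.
   Context: A multiplicative set $S$ of a commutative ring $R$ is a subset with $0\notin S$, $1\in S$, and $st\in S$ for all $s,t\in S$. It is strongly multiplicative if $\bigl(\bigcap_{i\in\Delta}s_iR\bigr)\cap S\neq\varnothing$ for every family $(s_i)_{i\in\Delta}$ of elements of $S$. *)

theory Defs
  imports "HOL-Algebra.Algebra"
begin

definition multiplicative_set :: "('a, 'b) ring_scheme \<Rightarrow> 'a set \<Rightarrow> bool" where
  "multiplicative_set R S \<longleftrightarrow>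
     S \<subseteq> carrier R \<and> \<zero>\<^bsub>R\<^esub> \<notin> S \<and> \<one>\<^bsub>R\<^esub> \<in> S \<and>
     (\<forall>s\<in>S. \<forall>t\<in>S. s \<otimes>\<^bsub>R\<^esub> t \<in> S)"

(* HOL cannot quantify over index types inside a definition, so families are indexed by
   subsets of the element type of R.  This loses nothing, since the condition depends only on
   the range of the family: see strongly_multiplicative_family for arbitrary index types.
   For the empty family the intersection is the whole type, and the intersection with S is
   S itself, as it is when the empty intersection is read as R. *)
definition strongly_multiplicative :: "('a, 'b) ring_scheme \<Rightarrow> 'a set \<Rightarrow> bool" where
  "strongly_multiplicative R S \<longleftrightarrow>
     multiplicative_set R S \<and>
     (\<forall>(\<Delta> :: 'a set) (s :: 'a \<Rightarrow> 'a).
        (\<forall>i\<in>\<Delta>. s i \<in> S) \<longrightarrow> (\<Inter>i\<in>\<Delta>. PIdl\<^bsub>R\<^esub> (s i)) \<inter> S \<noteq> {})"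

lemma strongly_multiplicative_family:
  fixes \<Delta> :: "'i set" and s :: "'i \<Rightarrow> 'a"
  assumes "strongly_multiplicative R S" and "\<And>i. i \<in> \<Delta> \<Longrightarrow> s i \<in> S"
  shows "(\<Inter>i\<in>\<Delta>. PIdl\<^bsub>R\<^esub> (s i)) \<inter> S \<noteq> {}"
proof -
  have "\<forall>a\<in>s ` \<Delta>. id a \<in> S"
    using assms(2) by auto
  then have "(\<Inter>a\<in>s ` \<Delta>. PIdl\<^bsub>R\<^esub> (id a)) \<inter> S \<noteq> {}"
    using assms(1) unfolding strongly_multiplicative_def by blast
  then show ?thesis
    by simp
qed

definition maximal_ideal_avoiding :: "('a, 'b) ring_scheme \<Rightarrow> 'a set \<Rightarrow> 'a set \<Rightarrow> 'a set \<Rightarrow> bool" where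
  "maximal_ideal_avoiding R I S J \<longleftrightarrow>
     ideal J R \<and> I \<subseteq> J \<and> J \<inter> S = {} \<and>
     (\<forall>K. ideal K R \<and> I \<subseteq> K \<and> K \<inter> S = {} \<and> J \<subseteq> K \<longrightarrow> K = J)"

end

(* Strong multiplicativity, applied to the family of all elements of S, yields t in S that every
   element of S divides, so an ideal avoids S iff it avoids t.  Since t^2 is in S, also t = t^2 r.
   Let J be maximal among the ideals that contain I and avoid t.  The colon ideal (J : t) contains J
   and avoids t, because t^2 in J would give t in J; so it equals J, and 1 - tr, which t
   annihilates, lies in J.  An ideal strictly larger than J contains t and 1 - tr, hence 1. *)
theory Submission
  imports Defs
begin

text \<open>Zorn's lemma: avoiding \<open>S\<close> is inherited by unions of chains, and
  \<open>I\<close> itself shows that the family is nonempty.\<close>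

lemma (in ring) ex_maximal_ideal_avoiding:
  assumes "ideal I R" and "I \<inter> S = {}"
  shows "\<exists>J. maximal_ideal_avoiding R I S J"
proof -
  define \<A> where "\<A> = {J. ideal J R \<and> I \<subseteq> J \<and> J \<inter> S = {}}"
  \<comment> \<open>The empty chain is excluded because its union is empty and so not an
    ideal.\<close>
  have Un: "\<Union>\<C> \<in> \<A>" if "\<C> \<noteq> {}" and chain: "subset.chain \<A> \<C>" for \<C>
  proof -
    have sub: "\<C> \<subseteq> \<A>"
      using chain by (simp add: pred_on.chain_def)
    have "subset.chain {J. ideal J R} \<C>"
      using chain by (auto simp: pred_on.chain_def \<A>_def)
    from chain_Union_is_ideal[OF this] have "ideal (\<Union>\<C>) R"
      using \<open>\<C> \<noteq> {}\<close> by simp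
    moreover have "I \<subseteq> \<Union>\<C>"
      using sub \<open>\<C> \<noteq> {}\<close> by (auto simp: \<A>_def)
    moreover have "\<Union>\<C> \<inter> S = {}"
      using sub by (auto simp: \<A>_def)
    ultimately show ?thesis
      by (simp add: \<A>_def)
  qed
  have "\<A> \<noteq> {}"
    using assms by (auto simp: \<A>_def)
  then have "\<exists>J\<in>\<A>. \<forall>K\<in>\<A>. J \<subseteq> K \<longrightarrow> K = J"
    by (rule subset_Zorn_nonempty) (rule Un)
  then obtain J where "J \<in> \<A>" and "\<forall>K\<in>\<A>. J \<subseteq> K \<longrightarrow> K = J" ..
  then have "maximal_ideal_avoiding R I S J"
    by (simp add: maximal_ideal_avoiding_def \<A>_def)
  then show ?thesis ..
qed

text \<open>The family is \<open>S\<close> indexed by itself; any point of its intersection that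
  lies in \<open>S\<close> serves as \<open>t\<close>.\<close>

lemma strongly_multiplicative_common_multiple:
  assumes "strongly_multiplicative R S"
  obtains t where "t \<in> S" and "\<And>s. s \<in> S \<Longrightarrow> t \<in> PIdl\<^bsub>R\<^esub> s"
  using strongly_multiplicative_family[OF assms, of S "\<lambda>s. s"] by blast

lemma (in cring) maximal_ideal_avoiding_imp_maximalideal:
  assumes S: "strongly_multiplicative R S" and J: "maximal_ideal_avoiding R I S J"
  shows "maximalideal J R"
proof -
  obtain t where t: "t \<in> S" and dvd: "\<And>s. s \<in> S \<Longrightarrow> t \<in> PIdl s"
    using strongly_multiplicative_common_multiple[OF S] by blast
  have mult: "multiplicative_set R S"
    using S by (simp add: strongly_multiplicative_def)
  then have S_carr: "S \<subseteq> carrier R" and tt: "t \<otimes> t \<in> S"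
    using t by (auto simp: multiplicative_set_def)
  then have tc: "t \<in> carrier R"
    using t by blast
  \<comment> \<open>An ideal containing \<open>s\<close> contains the principal ideal of
    \<open>s\<close>, and \<open>t\<close> lies in that.\<close>
  have t_mem: "t \<in> K" if "ideal K R" and "s \<in> K" and "s \<in> S" for K s
    using cgenideal_minimal[OF that(1,2)] dvd[OF that(3)] by blast
  \<comment> \<open>Since \<open>I \<subseteq> J\<close>, every ideal above \<open>J\<close>
    contains \<open>I\<close>, so \<open>max\<close> only has to compare with
    \<open>J\<close>.\<close>
  from J have idJ: "ideal J R" and JS: "J \<inter> S = {}"
    and max: "\<And>K. \<lbrakk>ideal K R; J \<subseteq> K; K \<inter> S = {}\<rbrakk> \<Longrightarrow> K = J"
    unfolding maximal_ideal_avoiding_def by blast+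
  interpret J: ideal J R by (rule idJ)
  obtain r where r: "r \<in> carrier R" and tr: "t = r \<otimes> (t \<otimes> t)"
    using dvd[OF tt] unfolding cgenideal_def by blast
  \<comment> \<open>As \<open>t\<close> is a multiple of its own square, \<open>e\<close> is an
    idempotent that fixes \<open>t\<close>.\<close>
  define e where "e = t \<otimes> r"
  have ec: "e \<in> carrier R"
    using tc r by (simp add: e_def)
  have "t \<otimes> e = r \<otimes> (t \<otimes> t)"
    using tc r by (simp add: e_def m_ac)
  then have te: "t \<otimes> e = t"
    using tr by (rule trans[OF _ sym])
  \<comment> \<open>This is the colon ideal \<open>(J : t)\<close>.\<close>
  define L where "L = {x \<in> carrier R. t \<otimes> x \<in> J}"
  have idL: "ideal L R"
    unfolding L_def by (rule J.helper_max_prime[OF is_cring tc])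
  moreover have "J \<subseteq> L"
    using tc J.I_l_closed J.a_subset by (auto simp: L_def)
  moreover have "L \<inter> S = {}"
  proof (rule ccontr)
    assume "L \<inter> S \<noteq> {}"
    \<comment> \<open>Membership of \<open>t\<close> in \<open>L\<close> puts
      \<open>t \<otimes> t\<close> into \<open>J\<close>, although this square lies in
      \<open>S\<close>.\<close>
    then have "t \<in> L"
      using t_mem[OF idL] by blast
    then show False
      using JS tt by (auto simp: L_def)
  qed
  ultimately have LJ: "L = J"
    by (rule max)
  have "t \<otimes> (\<one> \<ominus> e) = \<zero>"
    using tc ec te by (simp add: r_distr minus_eq r_minus r_neg)
  then have "\<one> \<ominus> e \<in> L"
    using ec by (simp add: L_def)
  then have compl: "\<one> \<ominus> e \<in> J"
    by (simp only: LJ)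
  show ?thesis
  proof (rule maximalidealI[OF idJ])
    show "carrier R \<noteq> J"
      using t tc JS by blast
  next
    fix K assume K: "ideal K R" "J \<subseteq> K" "K \<subseteq> carrier R"
    interpret K: ideal K R by (rule K(1))
    show "K = J \<or> K = carrier R"
    \<comment> \<open>If \<open>K\<close> avoids \<open>S\<close>, maximality gives
      \<open>K = J\<close>. Otherwise \<open>K\<close> contains \<open>t\<close>, hence its multiple
      \<open>e\<close>, as well as the complement \<open>\<one> \<ominus> e\<close> from
      \<open>J\<close>; these add up to \<open>\<one>\<close>.\<close>
    proof (cases "K \<inter> S = {}")
      case True
      then show ?thesis
        using max K by blast
    next
      case False
      then have "t \<in> K"
        using t_mem[OF K(1)] by blast
      then have "e \<in> K"
        using r by (simp add: e_def K.I_r_closed)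
      then have "(\<one> \<ominus> e) \<oplus> e \<in> K"
        using compl K(2) by (intro K.a_closed) auto
      moreover have "(\<one> \<ominus> e) \<oplus> e = \<one>"
        using ec by (simp add: minus_eq a_assoc l_neg)
      ultimately show ?thesis
        using K.one_imp_carrier by simp
    qed
  qed
qed

theorem theorem6p1:
  fixes R :: "('a, 'b) ring_scheme" and S I :: "'a set"
  assumes "cring R" and "\<one>\<^bsub>R\<^esub> \<noteq> \<zero>\<^bsub>R\<^esub>"
    and "strongly_multiplicative R S"
    and "ideal I R" and "I \<inter> S = {}"
  shows "(\<exists>M. maximalideal M R \<and> I \<subseteq> M \<and> M \<inter> S = {}) \<and>
         (\<forall>J. maximal_ideal_avoiding R I S J \<longrightarrow> maximalideal J R)"
proof -
  interpret cring R by fact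
  have max: "maximalideal J R" if "maximal_ideal_avoiding R I S J" for J
    using assms(3) that by (rule maximal_ideal_avoiding_imp_maximalideal)
  obtain M where "maximal_ideal_avoiding R I S M"
    using ex_maximal_ideal_avoiding[OF assms(4,5)] by blast
  then have "maximalideal M R \<and> I \<subseteq> M \<and> M \<inter> S = {}"
    using max by (simp add: maximal_ideal_avoiding_def)
  then show ?thesis
    using max by blast
qed

end
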